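(* Let $X$ be a real random variable (the running variable), let $Y^0,Y^1$ be random elements of $\mathcal Y$ (the potential outcome distributions), let $T=\mathbf 1\{X\ge 0\}$, and let the observed outcome be $Y=Y^1$ if $T=1$ and $Y=Y^0$ if $T=0$. Assume: (1) for some $\varepsilon>0$, for each $t\in\{0,1\}$ and all $q\in[0,1]$, the map $x\mapsto E[Q_{Y^t}(q)\mid X=x]$ is continuous on $(-\varepsilon,\varepsilon)$; (2) the cdf $F_X$ of $X$ is differentiable at $0$, and its density $f_X$ satisfies $0<\lim_{x\to 0}f_X(x)<\infty$. Then the (unobserved) local average quantile treatment effect $$\tau^{\mathrm{R3D}}(q):=E\big[Q_{Y^1}(q)-Q_{Y^0}(q)\mid X=0\big],\qquad q\in[0,1],$$ is identified from the joint distribution of the observed $(X,Y)$ as $$\tau^{\mathrm{R3D}}(q)=\lim_{x\to0^+}E[Q_Y(q)\mid X=x]-\lim_{x\to0^-}E[Q_Y(q)\mid X=x].$$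
   Context: $\mathcal Y$ is the set of cumulative distribution functions $G$ on $\mathbb R$ with $\int x^2\,dG(x)<\infty$. For $G\in\mathcal Y$, $Q_G(q)=\inf\{y\in\mathbb R: q\le G(y)\}$ is its quantile function. The outcome is thus a random distribution, and $E[Q_Y(q)\mid X=x]$ is an expectation with respect to the conditional law of the random cdf $Y$ given $X=x$, which is assumed to exist. The cutoff is normalized to $0$ (sharp regression discontinuity design).
   Formalization: Quantiles and expectations are taken in the extended reals; the identity is asserted only when the two one-sided limits are not infinite of the same sign. This excludes q=0, where every quantile is −∞ and both sides are the undefined (−∞)−(−∞). *)

theory Defs
  imports "HOL-Probability.Probability"
begin

(* The cdfs of Borel probability measures on the line with finite second moment. *)
definition sq_int_cdfs :: "(real \<Rightarrow> real) set" where
  "sq_int_cdfs =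
     {cdf \<mu> | \<mu>. real_distribution \<mu> \<and> integrable \<mu> (\<lambda>y. y\<^sup>2)}"

(* The sigma-algebra is generated by the evaluations G \<mapsto> G y: a map into this space is
   measurable iff it is a random cdf in the usual sense. It is also the Borel sigma-algebra of
   the 2-Wasserstein distance. *)
definition cdf_space :: "(real \<Rightarrow> real) measure" where
  "cdf_space = restrict_space (\<Pi>\<^sub>M y\<in>UNIV. borel) sq_int_cdfs"

(* The infimum is taken in the extended reals, so that quantile G 0 = -\<infinity>, and
   quantile G 1 = \<infinity> if G does not attain the value 1. *)
definition quantile :: "(real \<Rightarrow> real) \<Rightarrow> real \<Rightarrow> ereal" where
  "quantile G q = (INF y\<in>{y. q \<le> G y}. ereal y)"

(* Expectation of an extended-real function: integral of the positive part minus integral of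
   the negative part (e2ennreal sends negative values to 0). It is meaningful only under
   has_expectation, which excludes \<infinity> - \<infinity>. *)
definition has_expectation :: "'a measure \<Rightarrow> ('a \<Rightarrow> ereal) \<Rightarrow> bool" where
  "has_expectation \<mu> f \<longleftrightarrow> f \<in> borel_measurable \<mu> \<and>
     ((\<integral>\<^sup>+x. e2ennreal (f x) \<partial>\<mu>) < \<infinity> \<or> (\<integral>\<^sup>+x. e2ennreal (- f x) \<partial>\<mu>) < \<infinity>)"

definition ext_expectation :: "'a measure \<Rightarrow> ('a \<Rightarrow> ereal) \<Rightarrow> ereal" where
  "ext_expectation \<mu> f =
     enn2ereal (\<integral>\<^sup>+x. e2ennreal (f x) \<partial>\<mu>) - enn2ereal (\<integral>\<^sup>+x. e2ennreal (- f x) \<partial>\<mu>)"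

(* K is a version of the regular conditional law of Z given X, where J is the joint law of
   (X, Z) and Z takes values in N. Two versions agree only for almost every x. *)
definition cond_law ::
    "'b measure \<Rightarrow> (real \<times> 'b) measure \<Rightarrow> (real \<Rightarrow> 'b measure) \<Rightarrow> bool" where
  "cond_law N J K \<longleftrightarrow> K \<in> borel \<rightarrow>\<^sub>M prob_algebra N \<and>
     (\<forall>A\<in>sets borel. \<forall>B\<in>sets N.
        emeasure J (A \<times> B) = (\<integral>\<^sup>+x. indicator A x * emeasure (K x) B \<partial>distr J borel fst))"

(* E[g(Z) | X = x], computed from the version K, is well defined for x near the limit point
   and tends to l. *)
definition cond_exp_tendsto ::
    "(real \<Rightarrow> 'b measure) \<Rightarrow> ('b \<Rightarrow> ereal) \<Rightarrow> real filter \<Rightarrow> ereal \<Rightarrow> bool" where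
  "cond_exp_tendsto K g F l \<longleftrightarrow> (\<forall>\<^sub>F x in F. has_expectation (K x) g) \<and>
     ((\<lambda>x. ext_expectation (K x) g) \<longlongrightarrow> l) F"

(* f is a Lebesgue density of \<mu> on the set S; nothing is required of \<mu> outside S. *)
definition density_on :: "real set \<Rightarrow> real measure \<Rightarrow> (real \<Rightarrow> real) \<Rightarrow> bool" where
  "density_on S \<mu> f \<longleftrightarrow> f \<in> borel_measurable borel \<and> (\<forall>x\<in>S. 0 \<le> f x) \<and>
     (\<forall>A\<in>sets borel. A \<subseteq> S \<longrightarrow>
        emeasure \<mu> A = (\<integral>\<^sup>+x. indicator A x * ennreal (f x) \<partial>lborel))"

(* In a pair of potential outcomes the first component is the untreated one (t = 0). *)
definition effect :: "((real \<Rightarrow> real) \<times> (real \<Rightarrow> real)) \<Rightarrow> real \<Rightarrow> ereal" where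
  "effect y q = quantile (snd y) q - quantile (fst y) q"

end

theory Submission
  imports Defs
begin

text \<open>
  For \<open>x \<ge> 0\<close> the law of \<open>Y\<^sup>1\<close> given \<open>X = x\<close> is a version of the law of \<open>Y\<close> given \<open>X = x\<close>, and likewise
  for \<open>Y\<^sup>0\<close> and \<open>x < 0\<close>, so with this version the one-sided limits are the values at \<open>0\<close> of the
  continuous functions \<open>x \<mapsto> E[Q(q) | X = x]\<close> for \<open>Q\<close> the quantile functions of \<open>Y\<^sup>1\<close> and \<open>Y\<^sup>0\<close>.
  Any other version yields the same conditional expectation for almost every \<open>x\<close>. As \<open>X\<close> has a
  positive density near \<open>0\<close>, such \<open>x\<close> accumulate at \<open>0\<close> from both sides, so the limits do not
  depend on the version.
\<close>

section \<open>Expectation of a difference in the extended reals\<close>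

text \<open>Once \<open>a\<close>, \<open>b\<close>, \<open>c\<close> are real they can be
  cancelled; if \<open>y\<close> or \<open>z\<close> is infinite, then so is \<open>x\<close>, and
  each equation has the same infinity on both sides. The second equation serves the case where the
  roles of positive and negative parts are exchanged.\<close>

lemma ereal_diff_diff_eq:
  fixes x y z :: ereal and a b c :: real
  assumes "x + (ereal a + ereal b) = ereal c + (y + z)" "0 \<le> y" "0 \<le> z"
  shows "x - ereal c = (y - ereal a) - (ereal b - z) \<and> ereal c - x = (ereal a - y) - (z - ereal b)"
proof (cases "\<bar>y\<bar> = \<infinity> \<or> \<bar>z\<bar> = \<infinity>")
  case True
  then have "x = \<infinity>"
    using assms by (cases x; cases y; simp)
  then show ?thesis
    using True assms(2,3) by (cases y; cases z; simp)
next
  case False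
  then obtain r s where "y = ereal r" "z = ereal s"
    by auto
  then show ?thesis
    using assms(1) by (cases x; simp)
qed

text \<open>Here \<open>p\<close>, \<open>n\<close> and \<open>p'\<close>, \<open>n'\<close> stand
  for the integrals of the positive and negative parts of two functions, and \<open>P\<close>,
  \<open>N\<close> for those of their difference. Assumption \<open>fin\<close> rules out two equal
  infinite expectations; it makes one side of \<open>eq\<close> finite apart from one summand, so
  that cancellation is legitimate.\<close>

lemma enn2ereal_diff_diff_eq:
  fixes P N p n p' n' :: ennreal
  assumes eq: "P + (n + p') = N + (p + n')" and P: "P \<le> p + n'" and N: "N \<le> n + p'"
    and pn: "p < \<infinity> \<or> n < \<infinity>" "p' < \<infinity> \<or> n' < \<infinity>"
    and fin: "\<not> (enn2ereal p - enn2ereal n = enn2ereal p' - enn2ereal n' \<and>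
        \<bar>enn2ereal p - enn2ereal n\<bar> = \<infinity>)"
  shows "(P < \<infinity> \<or> N < \<infinity>) \<and>
    enn2ereal P - enn2ereal N = (enn2ereal p - enn2ereal n) - (enn2ereal p' - enn2ereal n')"
proof -
  have real: "\<exists>r. enn2ereal x = ereal r" if "x < \<infinity>" for x
    using that by (cases x; simp add: enn2ereal_ennreal)
  have eq': "enn2ereal P + (enn2ereal n + enn2ereal p') = enn2ereal N + (enn2ereal p + enn2ereal n')"
    using arg_cong[OF eq, of enn2ereal] by (simp only: plus_ennreal.rep_eq)
  \<comment> \<open>Otherwise, by \<open>pn\<close>, both differences are
    \<open>-\<infinity>\<close> or both are \<open>\<infinity>\<close>, contrary to
    \<open>fin\<close>.\<close>
  have "n < \<infinity> \<and> p' < \<infinity> \<or> p < \<infinity> \<and> n' < \<infinity>"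
  proof (rule ccontr)
    assume "\<not> ?thesis"
    then consider "n = \<infinity>" "n' = \<infinity>" "p < \<infinity>" "p' < \<infinity>" | "p = \<infinity>" "p' = \<infinity>" "n < \<infinity>" "n' < \<infinity>"
      using pn by (auto simp: less_top[symmetric])
    then show False
    proof cases
      case 1
      then show False using fin by (cases p; cases p'; simp add: enn2ereal_ennreal)
    next
      case 2
      then show False using fin by (cases n; cases n'; simp add: enn2ereal_ennreal)
    qed
  qed
  then show ?thesis
  proof
    assume np': "n < \<infinity> \<and> p' < \<infinity>"
    then have "N < \<infinity>"
      using N by (auto intro: le_less_trans simp: ennreal_add_less_top)
    obtain a b c where abc: "enn2ereal n = ereal a" "enn2ereal p' = ereal b" "enn2ereal N = ereal c"
      using real[of n] real[of p'] real[of N] np' \<open>N < \<infinity>\<close> by blast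
    show ?thesis
      unfolding abc
      using ereal_diff_diff_eq[OF eq'[unfolded abc] enn2ereal_nonneg enn2ereal_nonneg] \<open>N < \<infinity>\<close>
      by blast
  next
    assume pn': "p < \<infinity> \<and> n' < \<infinity>"
    then have "P < \<infinity>"
      using P by (auto intro: le_less_trans simp: ennreal_add_less_top)
    obtain a b c where abc: "enn2ereal p = ereal a" "enn2ereal n' = ereal b" "enn2ereal P = ereal c"
      using real[of p] real[of n'] real[of P] pn' \<open>P < \<infinity>\<close> by blast
    show ?thesis
      unfolding abc
      using ereal_diff_diff_eq[OF eq'[symmetric, unfolded abc] enn2ereal_nonneg enn2ereal_nonneg] \<open>P < \<infinity>\<close>
      by blast
  qed
qed

text \<open>Pointwise relations between the positive and negative parts of \<open>u\<close>,
  \<open>v\<close> and \<open>u - v\<close> are integrated; what remains is arithmetic with six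
  integrals.\<close>

lemma expectation_diff:
  assumes f: "has_expectation \<mu> f" and g: "has_expectation \<mu> g"
    and fin: "\<not> (ext_expectation \<mu> f = ext_expectation \<mu> g \<and> \<bar>ext_expectation \<mu> f\<bar> = \<infinity>)"
  shows "has_expectation \<mu> (\<lambda>x. f x - g x) \<and>
    ext_expectation \<mu> (\<lambda>x. f x - g x) = ext_expectation \<mu> f - ext_expectation \<mu> g"
proof -
  have [measurable]: "f \<in> borel_measurable \<mu>" "g \<in> borel_measurable \<mu>"
    using f g by (simp_all add: has_expectation_def)
  have "ennreal (r - s) + (ennreal (- r) + ennreal s) = ennreal (- (r - s)) + (ennreal r + ennreal (- s))"
    for r s :: real
    by (cases "0 \<le> r"; cases "0 \<le> s"; cases "s \<le> r"; simp add: ennreal_neg flip: ennreal_plus)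
  \<comment> \<open>With all negative parts moved to the other side no subtraction of integrals occurs, and the
    identity also holds in the degenerate cases \<open>\<infinity> - \<infinity>\<close>.\<close>
  then have parts: "e2ennreal (u - v) + (e2ennreal (- u) + e2ennreal v) =
      e2ennreal (- (u - v)) + (e2ennreal u + e2ennreal (- v))" for u v
    by (cases u; cases v; simp add: e2ennreal_neg)
  have "ennreal (r - s) \<le> ennreal r + ennreal (- s)" for r s :: real
    by (cases "0 \<le> r"; cases "0 \<le> s"; simp add: ennreal_neg ennreal_leI flip: ennreal_plus)
  then have pos: "e2ennreal (u - v) \<le> e2ennreal u + e2ennreal (- v)" for u v
    by (cases u; cases v; simp add: e2ennreal_neg)
  \<comment> \<open>The terms \<open>- (u - v)\<close> and \<open>v - u\<close> differ only if
    \<open>u\<close> and \<open>v\<close> are the same infinity; then \<open>u - v\<close> is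
    \<open>\<infinity>\<close> and the left-hand side is 0.\<close>
  have neg: "e2ennreal (- (u - v)) \<le> e2ennreal (- u) + e2ennreal v" for u v
    using pos[of v u] by (cases u; cases v; simp add: add.commute e2ennreal_neg)
  have "((\<integral>\<^sup>+x. e2ennreal (f x - g x) \<partial>\<mu>) < \<infinity> \<or> (\<integral>\<^sup>+x. e2ennreal (- (f x - g x)) \<partial>\<mu>) < \<infinity>) \<and>
      ext_expectation \<mu> (\<lambda>x. f x - g x) = ext_expectation \<mu> f - ext_expectation \<mu> g"
    unfolding ext_expectation_def
  proof (rule enn2ereal_diff_diff_eq)
    show "\<not> (enn2ereal (\<integral>\<^sup>+x. e2ennreal (f x) \<partial>\<mu>) - enn2ereal (\<integral>\<^sup>+x. e2ennreal (- f x) \<partial>\<mu>) =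
          enn2ereal (\<integral>\<^sup>+x. e2ennreal (g x) \<partial>\<mu>) - enn2ereal (\<integral>\<^sup>+x. e2ennreal (- g x) \<partial>\<mu>) \<and>
        \<bar>enn2ereal (\<integral>\<^sup>+x. e2ennreal (f x) \<partial>\<mu>) - enn2ereal (\<integral>\<^sup>+x. e2ennreal (- f x) \<partial>\<mu>)\<bar> = \<infinity>)"
      using fin unfolding ext_expectation_def .
  qed (use f g in \<open>simp_all add: has_expectation_def parts pos neg nn_integral_mono
      flip: nn_integral_add\<close>)
  then show ?thesis
    by (simp add: has_expectation_def)
qed

section \<open>Measurability of quantiles\<close>

lemma measurable_cdf_space_eval:
  "(\<lambda>G. G y) \<in> borel_measurable cdf_space"
  unfolding cdf_space_def
  by (intro measurable_restrict_space1 measurable_component_singleton) simp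

lemma mono_sq_int_cdfs:
  assumes "G \<in> sq_int_cdfs"
  shows "mono G"
proof -
  obtain \<mu> where \<mu>: "G = cdf \<mu>" "real_distribution \<mu>"
    using assms by (auto simp: sq_int_cdfs_def)
  show ?thesis
    using finite_borel_measure.cdf_nondecreasing[OF real_distribution.finite_borel_measure_M[OF \<mu>(2)]]
    by (simp add: \<mu>(1) mono_def)
qed

text \<open>By monotonicity a point below \<open>y\<close> where \<open>G\<close> reaches
  \<open>q\<close> can be moved slightly to the right, to a rational that is still below
  \<open>y\<close>. This turns the sublevel sets of the quantile into countable unions of conditions
  on evaluations of \<open>G\<close>.\<close>

lemma quantile_less_iff:
  assumes "mono G"
  shows "quantile G q < y \<longleftrightarrow> (\<exists>r::rat. ereal (of_rat r) < y \<and> q \<le> G (of_rat r))"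
proof
  assume "quantile G q < y"
  then obtain z where z: "q \<le> G z" "ereal z < y"
    by (auto simp: quantile_def INF_less_iff)
  \<comment> \<open>As \<open>y\<close> may be infinite, a real \<open>w\<close> in between is
    needed before a rational can be chosen.\<close>
  obtain w where w: "z < w" "ereal w < y"
  proof (cases y)
    case (real r)
    then show ?thesis using z dense[of z r] that by auto
  next
    case PInf
    then show ?thesis using that[of "z + 1"] by simp
  qed (use z in auto)
  obtain r where r: "z < of_rat r" "of_rat r < w"
    using of_rat_dense[OF w(1)] by blast
  have "ereal (of_rat r) < y"
    using r(2) w(2) by (meson less_ereal.simps(1) less_trans)
  moreover have "q \<le> G (of_rat r)"
    using z(1) monoD[OF assms, of z "of_rat r"] r(1) by simp
  ultimately show "\<exists>r::rat. ereal (of_rat r) < y \<and> q \<le> G (of_rat r)" by blast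
qed (auto simp: quantile_def INF_less_iff)

lemma measurable_quantile [measurable]:
  "(\<lambda>G. quantile G q) \<in> borel_measurable cdf_space"
proof (rule borel_measurableI_less)
  fix y :: ereal
  note measurable_cdf_space_eval [measurable]
  have "space cdf_space \<subseteq> sq_int_cdfs"
    by (auto simp: cdf_space_def space_restrict_space)
  then have "{G \<in> space cdf_space. quantile G q < y} =
      {G \<in> space cdf_space. \<exists>r::rat. ereal (of_rat r) < y \<and> q \<le> G (of_rat r)}"
    using quantile_less_iff mono_sq_int_cdfs by blast
  also have "\<dots> \<in> sets cdf_space"
    by measurable
  finally show "{G \<in> space cdf_space. quantile G q < y} \<in> sets cdf_space" .
qed

section \<open>Conditional laws and their versions\<close>

lemma has_expectation_distr:
  assumes "h \<in> \<mu> \<rightarrow>\<^sub>M N" "f \<in> borel_measurable N"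
  shows "has_expectation (distr \<mu> N h) f \<longleftrightarrow> has_expectation \<mu> (\<lambda>x. f (h x))"
  using assms measurable_compose[OF assms]
  by (simp add: has_expectation_def nn_integral_distr)

lemma ext_expectation_distr:
  assumes "h \<in> \<mu> \<rightarrow>\<^sub>M N" "f \<in> borel_measurable N"
  shows "ext_expectation (distr \<mu> N h) f = ext_expectation \<mu> (\<lambda>x. f (h x))"
  using assms by (simp add: ext_expectation_def nn_integral_distr)

lemma cond_law_kernelD:
  assumes "cond_law N J K"
  shows "sets (K x) = sets N" "K \<in> borel \<rightarrow>\<^sub>M subprob_algebra N"
proof -
  have K: "K \<in> borel \<rightarrow>\<^sub>M prob_algebra N" using assms by (simp add: cond_law_def)
  show "sets (K x) = sets N"
    using measurable_space[OF K, of x] by (simp add: space_prob_algebra)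
  show "K \<in> borel \<rightarrow>\<^sub>M subprob_algebra N" by (rule measurable_prob_algebraD[OF K])
qed

text \<open>For a fixed set \<open>B\<close>, both \<open>emeasure (K x) B\<close> and
  \<open>emeasure (K' x) B\<close> are densities, with respect to the first marginal of
  \<open>J\<close>, of the measure that sends \<open>A\<close> to
  \<open>emeasure J (A \<times> B)\<close>, hence they agree almost everywhere. Induction on
  \<open>g\<close> extends this from indicators. The exceptional null set may depend on
  \<open>g\<close>.\<close>

lemma cond_law_AE_unique:
  assumes K: "cond_law N J K" and K': "cond_law N J K'"
    and "sigma_finite_measure (distr J borel fst)"
    and "g \<in> borel_measurable N"
  shows "AE x in distr J borel fst. (\<integral>\<^sup>+z. g z \<partial>K x) = (\<integral>\<^sup>+z. g z \<partial>K' x)"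
proof -
  let ?P = "distr J borel fst"
  note [measurable] = cond_law_kernelD(2)[OF K] cond_law_kernelD(2)[OF K']
  note sets_K = cond_law_kernelD(1)[OF K] cond_law_kernelD(1)[OF K']
  note meas_K = measurable_cong_sets[OF sets_K(1) refl] measurable_cong_sets[OF sets_K(2) refl]
  from assms(4) show ?thesis
  proof (induction g rule: borel_measurable_induct)
    case (cong f g)
    have "(\<integral>\<^sup>+z. f z \<partial>K x) = (\<integral>\<^sup>+z. g z \<partial>K x)" "(\<integral>\<^sup>+z. f z \<partial>K' x) = (\<integral>\<^sup>+z. g z \<partial>K' x)" for x
      using cong(3) sets_eq_imp_space_eq[OF sets_K(1)] sets_eq_imp_space_eq[OF sets_K(2)]
      by (auto intro!: nn_integral_cong)
    then show ?case using cong(4) by simp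
  next
    case (set B)
    have "AE x in ?P. emeasure (K x) B = emeasure (K' x) B"
    proof (rule sigma_finite_measure.density_unique2[OF assms(3)])
      show "(\<lambda>x. emeasure (K x) B) \<in> borel_measurable ?P"
        "(\<lambda>x. emeasure (K' x) B) \<in> borel_measurable ?P"
        using set by simp_all
      fix A assume "A \<in> sets ?P"
      then have "(\<integral>\<^sup>+x. indicator A x * emeasure (K x) B \<partial>?P) =
          (\<integral>\<^sup>+x. indicator A x * emeasure (K' x) B \<partial>?P)"
        using K K' set unfolding cond_law_def by simp
      then show "(\<integral>\<^sup>+x\<in>A. emeasure (K x) B \<partial>?P) = (\<integral>\<^sup>+x\<in>A. emeasure (K' x) B \<partial>?P)"
        by (simp add: mult.commute)
    qed
    then show ?case using set by (simp add: sets_K)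
  next
    case (mult u c)
    then show ?case
      by (simp add: nn_integral_cmult meas_K) (auto elim: eventually_mono)
  next
    case (add u v)
    have "AE x in ?P. (\<integral>\<^sup>+z. u z \<partial>K x) = (\<integral>\<^sup>+z. u z \<partial>K' x) \<and> (\<integral>\<^sup>+z. v z \<partial>K x) = (\<integral>\<^sup>+z. v z \<partial>K' x)"
      using add by simp
    then show ?case
      using add by (simp add: nn_integral_add meas_K) (auto elim: eventually_mono)
  next
    case (seq U)
    \<comment> \<open>The null sets of the countably many \<open>U i\<close> are merged before
      monotone convergence is applied for each \<open>x\<close>.\<close>
    have "AE x in ?P. \<forall>i. (\<integral>\<^sup>+z. U i z \<partial>K x) = (\<integral>\<^sup>+z. U i z \<partial>K' x)"
      using seq by (simp add: AE_all_countable)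
    moreover have "(\<integral>\<^sup>+z. (SUP i. U i) z \<partial>K x) = (SUP i. \<integral>\<^sup>+z. U i z \<partial>K x)"
      "(\<integral>\<^sup>+z. (SUP i. U i) z \<partial>K' x) = (SUP i. \<integral>\<^sup>+z. U i z \<partial>K' x)" for x
      unfolding SUP_apply
      using seq by (simp_all only: meas_K nn_integral_monotone_convergence_SUP)
    ultimately show ?case
      by (auto elim: eventually_mono)
  qed
qed

lemma cond_law_AE_ext_expectation_eq:
  assumes "cond_law N J K" and "cond_law N J K'"
    and "sigma_finite_measure (distr J borel fst)"
    and [measurable]: "g \<in> borel_measurable N"
  shows "AE x in distr J borel fst. ext_expectation (K x) g = ext_expectation (K' x) g"
proof -
  have "AE x in distr J borel fst. (\<integral>\<^sup>+z. e2ennreal (g z) \<partial>K x) = (\<integral>\<^sup>+z. e2ennreal (g z) \<partial>K' x)"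
    by (rule cond_law_AE_unique[OF assms(1-3)]) measurable
  moreover have "AE x in distr J borel fst. (\<integral>\<^sup>+z. e2ennreal (- g z) \<partial>K x) = (\<integral>\<^sup>+z. e2ennreal (- g z) \<partial>K' x)"
    by (rule cond_law_AE_unique[OF assms(1-3)]) measurable
  ultimately show ?thesis
    by eventually_elim (simp add: ext_expectation_def)
qed

text \<open>Cutting \<open>A\<close> at the cutoff splits the event that \<open>X\<close> lies in
  \<open>A\<close> and the observed outcome in \<open>B\<close> into an event about
  \<open>Y1\<close> and one about \<open>Y0\<close>. Each is a product event for the joint law of
  \<open>X\<close> and the pair of potential outcomes, which \<open>K\<close> disintegrates.\<close>

lemma cond_law_observed:
  fixes M :: "'a measure" and X :: "'a \<Rightarrow> real" and Y0 Y1 :: "'a \<Rightarrow> 'b"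
  assumes [measurable]: "X \<in> borel_measurable M" "Y0 \<in> M \<rightarrow>\<^sub>M N" "Y1 \<in> M \<rightarrow>\<^sub>M N"
    and K: "cond_law (N \<Otimes>\<^sub>M N) (distr M (borel \<Otimes>\<^sub>M (N \<Otimes>\<^sub>M N)) (\<lambda>\<omega>. (X \<omega>, (Y0 \<omega>, Y1 \<omega>)))) K"
  shows "cond_law N (distr M (borel \<Otimes>\<^sub>M N) (\<lambda>\<omega>. (X \<omega>, if X \<omega> \<ge> 0 then Y1 \<omega> else Y0 \<omega>)))
           (\<lambda>x. distr (K x) N (if x \<ge> 0 then snd else fst))"
    (is "cond_law N ?J ?K")
  unfolding cond_law_def
proof (intro conjI ballI)
  have [measurable]: "K \<in> borel \<rightarrow>\<^sub>M prob_algebra (N \<Otimes>\<^sub>M N)"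
    using K by (simp add: cond_law_def)
  have "(\<lambda>x. if x \<ge> 0 then distr (K x) N snd else distr (K x) N fst) \<in> borel \<rightarrow>\<^sub>M prob_algebra N"
    by measurable
  also have "(\<lambda>x. if x \<ge> 0 then distr (K x) N snd else distr (K x) N fst) = ?K"
    by auto
  finally show "?K \<in> borel \<rightarrow>\<^sub>M prob_algebra N" .
  fix A :: "real set" and B assume [measurable]: "A \<in> sets borel" "B \<in> sets N"
  let ?J' = "distr M (borel \<Otimes>\<^sub>M (N \<Otimes>\<^sub>M N)) (\<lambda>\<omega>. (X \<omega>, (Y0 \<omega>, Y1 \<omega>)))"
  let ?P = "distr M borel X"
  have P: "distr ?J borel fst = ?P" "distr ?J' borel fst = ?P"
    by (simp_all add: distr_distr comp_def)
  have sets_K: "sets (K x) = sets (N \<Otimes>\<^sub>M N)" for x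
    by (rule cond_law_kernelD(1)[OF K])
  have [measurable]: "K \<in> borel \<rightarrow>\<^sub>M subprob_algebra (N \<Otimes>\<^sub>M N)"
    by (rule cond_law_kernelD(2)[OF K])
  let ?B1 = "snd -` B \<inter> space (N \<Otimes>\<^sub>M N)" and ?B0 = "fst -` B \<inter> space (N \<Otimes>\<^sub>M N)"
  have [measurable]: "?B1 \<in> sets (N \<Otimes>\<^sub>M N)" "?B0 \<in> sets (N \<Otimes>\<^sub>M N)"
    by measurable
  have em: "emeasure ?J' (A' \<times> C) = (\<integral>\<^sup>+x. indicator A' x * emeasure (K x) C \<partial>?P)"
    if "A' \<in> sets borel" "C \<in> sets (N \<Otimes>\<^sub>M N)" for A' C
    using K that unfolding cond_law_def P by blast
  have "emeasure ?J (A \<times> B) =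
      emeasure M ((\<lambda>\<omega>. (X \<omega>, if X \<omega> \<ge> 0 then Y1 \<omega> else Y0 \<omega>)) -` (A \<times> B) \<inter> space M)"
    by (subst emeasure_distr) auto
  also have "(\<lambda>\<omega>. (X \<omega>, if X \<omega> \<ge> 0 then Y1 \<omega> else Y0 \<omega>)) -` (A \<times> B) \<inter> space M =
      (\<lambda>\<omega>. (X \<omega>, (Y0 \<omega>, Y1 \<omega>))) -` ((A \<inter> {0..}) \<times> ?B1) \<inter> space M \<union>
      (\<lambda>\<omega>. (X \<omega>, (Y0 \<omega>, Y1 \<omega>))) -` ((A \<inter> {..<0}) \<times> ?B0) \<inter> space M"
    using measurable_space[OF assms(2)] measurable_space[OF assms(3)]
    by (auto simp: space_pair_measure split: if_splits)
  also have "emeasure M \<dots> = emeasure ?J' ((A \<inter> {0..}) \<times> ?B1) + emeasure ?J' ((A \<inter> {..<0}) \<times> ?B0)"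
    by (subst plus_emeasure[symmetric]) (auto simp: emeasure_distr)
  also have "\<dots> = (\<integral>\<^sup>+x. indicator (A \<inter> {0..}) x * emeasure (K x) ?B1 +
      indicator (A \<inter> {..<0}) x * emeasure (K x) ?B0 \<partial>?P)"
    by (subst nn_integral_add) (simp_all add: em)
  also have "\<dots> = (\<integral>\<^sup>+x. indicator A x * emeasure (?K x) B \<partial>?P)"
  \<comment> \<open>For each \<open>x\<close> at most one of the two indicators is nonzero, and it
    selects the projection used in \<open>?K x\<close>.\<close>
  proof (rule nn_integral_cong)
    fix x
    have [measurable]: "fst \<in> K x \<rightarrow>\<^sub>M N" "snd \<in> K x \<rightarrow>\<^sub>M N"
      by (simp_all add: measurable_cong_sets[OF sets_K refl])
    show "indicator (A \<inter> {0..}) x * emeasure (K x) ?B1 + indicator (A \<inter> {..<0}) x * emeasure (K x) ?B0 =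
        indicator A x * emeasure (?K x) B"
      using sets_eq_imp_space_eq[OF sets_K[of x]]
      by (auto simp: emeasure_distr indicator_def)
  qed
  finally show "emeasure ?J (A \<times> B) = (\<integral>\<^sup>+x. indicator A x * emeasure (?K x) B \<partial>distr ?J borel fst)"
    by (simp add: P)
qed

section \<open>Limits at the cutoff from almost every point\<close>

text \<open>The positive limit makes the density positive on a punctured neighbourhood of 0. Every
  nonempty open interval inside it therefore has positive measure and contains a point where
  \<open>P\<close> holds.\<close>

lemma density_on_AE_frequently:
  assumes dens: "density_on {-\<delta><..<\<delta>} \<mu> f" and "\<delta> > 0" and sets_\<mu>: "sets \<mu> = sets borel"
    and "(f \<longlongrightarrow> l) (at 0)" "l > 0" and AE: "AE x in \<mu>. P x"
  shows "\<exists>\<^sub>F x in at_right 0. P x" and "\<exists>\<^sub>F x in at_left 0. P x"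
proof -
  have "\<forall>\<^sub>F x in at 0. f x > 0"
    using assms(4,5) by (rule order_tendstoD(1))
  then obtain d where d: "d > 0" "\<And>x. x \<noteq> 0 \<Longrightarrow> \<bar>x\<bar> < d \<Longrightarrow> f x > 0"
    by (auto simp: eventually_at)
  have [measurable]: "f \<in> borel_measurable borel"
    using dens by (simp add: density_on_def)
  \<comment> \<open>The point 0 is removed because the limit says nothing about the value of
    \<open>f\<close> there.\<close>
  have ex: "\<exists>x\<in>{a<..<b}. P x" if ab: "a < b" "{a<..<b} \<subseteq> {-d<..<d} \<inter> {-\<delta><..<\<delta>} - {0}" for a b
  proof (rule ccontr)
    assume "\<not> (\<exists>x\<in>{a<..<b}. P x)"
    with AE have "AE x in \<mu>. x \<notin> {a<..<b}" by (auto elim: eventually_mono)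
    then have "emeasure \<mu> {a<..<b} = 0"
      using AE_iff_null_sets[of "{a<..<b}" \<mu>] sets_\<mu> by auto
    moreover have "emeasure \<mu> {a<..<b} = (\<integral>\<^sup>+x. indicator {a<..<b} x * ennreal (f x) \<partial>lborel)"
    proof -
      have "{a<..<b} \<subseteq> {-\<delta><..<\<delta>}" using ab(2) by blast
      then show ?thesis using dens unfolding density_on_def by simp
    qed
    ultimately have "AE x in lborel. indicator {a<..<b} x * ennreal (f x) = 0"
      by (simp add: nn_integral_0_iff_AE)
    \<comment> \<open>A vanishing integral of a function positive on the interval makes the interval
      Lebesgue null, although its length is positive.\<close>
    then have "AE x in lborel. x \<notin> {a<..<b}"
    proof eventually_elim
      fix x assume 0: "indicator {a<..<b} x * ennreal (f x) = 0"
      show "x \<notin> {a<..<b}"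
      proof
        assume x: "x \<in> {a<..<b}"
        then have "x \<in> {-d<..<d} - {0}" using ab(2) by blast
        then have "f x > 0" by (intro d(2)) auto
        then show False using 0 x by simp
      qed
    qed
    then have "emeasure lborel {a<..<b} = 0"
      using AE_iff_null_sets[of "{a<..<b}" lborel] by auto
    then show False using ab(1) by simp
  qed
  show "\<exists>\<^sub>F x in at_right 0. P x"
    unfolding frequently_def eventually_at_right_field
  proof safe
    fix b :: real assume b: "0 < b" "\<forall>y>0. y < b \<longrightarrow> \<not> P y"
    have "\<exists>x\<in>{0<..<min b (min d \<delta>)}. P x"
      using b d(1) \<open>\<delta> > 0\<close> by (intro ex) (simp_all add: subset_eq)
    then show False using b(2) by auto
  qed
  show "\<exists>\<^sub>F x in at_left 0. P x"
    unfolding frequently_def eventually_at_left_field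
  proof safe
    fix b :: real assume b: "b < 0" "\<forall>y>b. y < 0 \<longrightarrow> \<not> P y"
    have "\<exists>x\<in>{max b (max (- d) (- \<delta>))<..<0}. P x"
      using b d(1) \<open>\<delta> > 0\<close> by (intro ex) (simp_all add: subset_eq)
    then show False using b(2) by auto
  qed
qed

text \<open>Both limits persist along the finer filter obtained by restriction to the set where
  \<open>f\<close> and \<open>g\<close> agree, and that filter is proper exactly because they agree
  frequently.\<close>

lemma tendsto_unique_frequently:
  fixes f g :: "'a \<Rightarrow> 'b::t2_space"
  assumes "(f \<longlongrightarrow> a) F" "(g \<longlongrightarrow> b) F" "\<exists>\<^sub>F x in F. f x = g x"
  shows "a = b"
proof -
  let ?F = "inf F (principal {x. f x = g x})"
  have "(f \<longlongrightarrow> a) ?F" "(g \<longlongrightarrow> b) ?F"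
    using assms(1,2) by (auto intro: tendsto_mono[OF inf_le1])
  moreover have "\<forall>\<^sub>F x in ?F. f x = g x"
    by (simp add: eventually_inf_principal)
  ultimately have "(f \<longlongrightarrow> b) ?F" "(f \<longlongrightarrow> a) ?F"
    by (simp_all add: tendsto_cong)
  moreover have "?F \<noteq> bot"
    using assms(3) by (simp add: trivial_limit_def eventually_inf_principal frequently_def)
  ultimately show ?thesis
    by (meson tendsto_unique)
qed

text \<open>Applied with \<open>h\<close> equal to \<open>snd\<close> to the right of the cutoff and
  to \<open>fst\<close> to the left, this carries limits for one potential outcome over to the
  observed outcome.\<close>

lemma cond_exp_tendsto_distr:
  assumes K: "cond_law N' J K" and h: "h \<in> N' \<rightarrow>\<^sub>M N" and g: "g \<in> borel_measurable N"
    and eq: "\<forall>\<^sub>F x in F. K' x = distr (K x) N h"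
    and ex: "\<forall>\<^sub>F x in F. has_expectation (K x) (\<lambda>y. g (h y))"
    and lim: "((\<lambda>x. ext_expectation (K x) (\<lambda>y. g (h y))) \<longlongrightarrow> l) F"
  shows "cond_exp_tendsto K' g F l"
proof -
  have h': "h \<in> K x \<rightarrow>\<^sub>M N" for x
    using h by (simp add: measurable_cong_sets[OF cond_law_kernelD(1)[OF K] refl])
  have "\<forall>\<^sub>F x in F. ext_expectation (K x) (\<lambda>y. g (h y)) = ext_expectation (K' x) g"
    using eq by eventually_elim (simp add: ext_expectation_distr[OF h' g])
  then have "((\<lambda>x. ext_expectation (K' x) g) \<longlongrightarrow> l) F"
    by (rule Lim_transform_eventually[OF lim])
  moreover have "\<forall>\<^sub>F x in F. has_expectation (K' x) g"
    using eq ex by eventually_elim (simp add: has_expectation_distr[OF h' g])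
  ultimately show ?thesis
    by (simp add: cond_exp_tendsto_def)
qed

lemma cond_exp_tendsto_unique:
  assumes "cond_exp_tendsto K g F a" "cond_exp_tendsto K' g F b"
    and "\<exists>\<^sub>F x in F. ext_expectation (K x) g = ext_expectation (K' x) g"
  shows "a = b"
  using assms unfolding cond_exp_tendsto_def by (blast intro: tendsto_unique_frequently)

section \<open>Identification of the treatment effect\<close>

theorem lemma1:
  fixes M :: "'a measure"
    and X :: "'a \<Rightarrow> real"
    and T :: "'a \<Rightarrow> nat"
    and Y0 Y1 Y :: "'a \<Rightarrow> real \<Rightarrow> real"
    and K :: "real \<Rightarrow> ((real \<Rightarrow> real) \<times> (real \<Rightarrow> real)) measure"
    and J :: "(real \<times> (real \<Rightarrow> real)) measure"
    and f\<^sub>X :: "real \<Rightarrow> real"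
    and \<epsilon> \<delta> :: real
    and \<tau> :: "real \<Rightarrow> ereal"
  assumes "prob_space M"
    and "X \<in> borel_measurable M"
    and "Y0 \<in> M \<rightarrow>\<^sub>M cdf_space"
    and "Y1 \<in> M \<rightarrow>\<^sub>M cdf_space"
    and T: "\<And>\<omega>. T \<omega> = (if X \<omega> \<ge> 0 then 1 else 0)"
    and Y: "\<And>\<omega>. Y \<omega> = (if T \<omega> = 1 then Y1 \<omega> else Y0 \<omega>)"
    and K: "cond_law (cdf_space \<Otimes>\<^sub>M cdf_space)
              (distr M (borel \<Otimes>\<^sub>M (cdf_space \<Otimes>\<^sub>M cdf_space)) (\<lambda>\<omega>. (X \<omega>, (Y0 \<omega>, Y1 \<omega>)))) K"
    and J: "J = distr M (borel \<Otimes>\<^sub>M cdf_space) (\<lambda>\<omega>. (X \<omega>, Y \<omega>))"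
    and "\<epsilon> > 0"
    and well_defined: "\<forall>pr\<in>{fst, snd}. \<forall>q\<in>{0..1}. \<forall>x\<in>{-\<epsilon><..<\<epsilon>}.
              has_expectation (K x) (\<lambda>y. quantile (pr y) q)"
    and continuity: "\<forall>pr\<in>{fst, snd}. \<forall>q\<in>{0..1}.
              continuous_on {-\<epsilon><..<\<epsilon>} (\<lambda>x. ext_expectation (K x) (\<lambda>y. quantile (pr y) q))"
    and "cdf (distr M borel X) differentiable at 0"
    and "\<delta> > 0"
    and "density_on {-\<delta><..<\<delta>} (distr M borel X) f\<^sub>X"
    and "\<exists>l>0. (f\<^sub>X \<longlongrightarrow> l) (at 0)"
    and \<tau>: "\<And>q. \<tau> q = ext_expectation (K 0) (\<lambda>y. effect y q)"
  shows "(\<exists>K\<^sub>Y. cond_law cdf_space J K\<^sub>Y \<and>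
            (\<forall>q\<in>{0..1}. \<exists>a b.
               cond_exp_tendsto K\<^sub>Y (\<lambda>G. quantile G q) (at_right 0) a \<and>
               cond_exp_tendsto K\<^sub>Y (\<lambda>G. quantile G q) (at_left 0) b)) \<and>
         (\<forall>K\<^sub>Y. cond_law cdf_space J K\<^sub>Y \<longrightarrow>
            (\<forall>q\<in>{0..1}. \<forall>a b.
               cond_exp_tendsto K\<^sub>Y (\<lambda>G. quantile G q) (at_right 0) a \<longrightarrow>
               cond_exp_tendsto K\<^sub>Y (\<lambda>G. quantile G q) (at_left 0) b \<longrightarrow>
               \<not> (a = b \<and> \<bar>a\<bar> = \<infinity>) \<longrightarrow>
               has_expectation (K 0) (\<lambda>y. effect y q) \<and> \<tau> q = a - b))"
proof -
  \<comment> \<open>A particular version of the law of the observed outcome, with which all others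
    are compared.\<close>
  define KY where "KY x = distr (K x) cdf_space (if x \<ge> 0 then snd else fst)" for x
  have J_eq: "J = distr M (borel \<Otimes>\<^sub>M cdf_space) (\<lambda>\<omega>. (X \<omega>, if X \<omega> \<ge> 0 then Y1 \<omega> else Y0 \<omega>))"
    unfolding J by (intro arg_cong[where f = "distr M (borel \<Otimes>\<^sub>M cdf_space)"] ext) (simp add: T Y)
  have KY: "cond_law cdf_space J KY"
    unfolding J_eq KY_def[abs_def] by (rule cond_law_observed[OF assms(2-4) K])
  note [measurable] = assms(2-4)
  have P: "distr J borel fst = distr M borel X"
    unfolding J_eq by (simp add: distr_distr comp_def)
  have P_sigma: "sigma_finite_measure (distr J borel fst)"
    unfolding P
    by (intro finite_measure.sigma_finite_measure prob_space.finite_measure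
        prob_space.prob_space_distr assms(1,2))
  obtain l where l: "l > 0" "(f\<^sub>X \<longlongrightarrow> l) (at 0)"
    using assms by blast
  let ?E = "\<lambda>pr q x. ext_expectation (K x) (\<lambda>y. quantile (pr y) q)"
  have lim: "cond_exp_tendsto KY (\<lambda>G. quantile G q) (at_right 0) (?E snd q 0)"
    "cond_exp_tendsto KY (\<lambda>G. quantile G q) (at_left 0) (?E fst q 0)"
    if q: "q \<in> {0..1}" for q
  proof -
    \<comment> \<open>Since 0 is interior to the interval of continuity, the limit from within any
      \<open>S\<close> is the value at 0; both one-sided limits are instances.\<close>
    have at0: "(?E pr q \<longlongrightarrow> ?E pr q 0) (at 0 within S)" if "pr \<in> {fst, snd}" for pr S
    proof -
      have "continuous_on {-\<epsilon><..<\<epsilon>} (?E pr q)"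
        using continuity that q by blast
      then have "isCont (?E pr q) 0"
        using \<open>\<epsilon> > 0\<close> by (simp add: continuous_on_eq_continuous_at)
      then show ?thesis
        by (auto simp: isCont_def intro: tendsto_within_subset)
    qed
    have r: "\<forall>\<^sub>F x in at_right 0. x \<in> {0<..<\<epsilon>}"
      using \<open>\<epsilon> > 0\<close> by (rule eventually_at_right_real)
    show "cond_exp_tendsto KY (\<lambda>G. quantile G q) (at_right 0) (?E snd q 0)"
    proof (rule cond_exp_tendsto_distr[OF K measurable_snd measurable_quantile])
      show "\<forall>\<^sub>F x in at_right 0. KY x = distr (K x) cdf_space snd"
        using r by eventually_elim (simp add: KY_def)
      show "\<forall>\<^sub>F x in at_right 0. has_expectation (K x) (\<lambda>y. quantile (snd y) q)"
        using r by eventually_elim (use well_defined q in auto)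
    qed (simp add: at0)
    have r: "\<forall>\<^sub>F x in at_left 0. x \<in> {-\<epsilon><..<0}"
      using \<open>\<epsilon> > 0\<close> by (intro eventually_at_left_real) simp
    show "cond_exp_tendsto KY (\<lambda>G. quantile G q) (at_left 0) (?E fst q 0)"
    proof (rule cond_exp_tendsto_distr[OF K measurable_fst measurable_quantile])
      show "\<forall>\<^sub>F x in at_left 0. KY x = distr (K x) cdf_space fst"
        using r by eventually_elim (simp add: KY_def)
      show "\<forall>\<^sub>F x in at_left 0. has_expectation (K x) (\<lambda>y. quantile (fst y) q)"
        using r by eventually_elim (use well_defined q in auto)
    qed (simp add: at0)
  qed
  show ?thesis
  proof (intro conjI allI impI ballI)
    show "\<exists>K\<^sub>Y. cond_law cdf_space J K\<^sub>Y \<and>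
            (\<forall>q\<in>{0..1}. \<exists>a b.
               cond_exp_tendsto K\<^sub>Y (\<lambda>G. quantile G q) (at_right 0) a \<and>
               cond_exp_tendsto K\<^sub>Y (\<lambda>G. quantile G q) (at_left 0) b)"
      using KY lim by blast
  next
    fix K\<^sub>Y q a b
    assume K\<^sub>Y: "cond_law cdf_space J K\<^sub>Y" and q: "q \<in> {0..1::real}"
      and a: "cond_exp_tendsto K\<^sub>Y (\<lambda>G. quantile G q) (at_right 0) a"
      and b: "cond_exp_tendsto K\<^sub>Y (\<lambda>G. quantile G q) (at_left 0) b"
      and fin: "\<not> (a = b \<and> \<bar>a\<bar> = \<infinity>)"
    have AE: "AE x in distr M borel X. ext_expectation (K\<^sub>Y x) (\<lambda>G. quantile G q) =
        ext_expectation (KY x) (\<lambda>G. quantile G q)"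
      by (rule cond_law_AE_ext_expectation_eq[OF K\<^sub>Y KY P_sigma measurable_quantile, unfolded P])
    \<comment> \<open>An arbitrary version agrees with \<open>KY\<close> only almost everywhere, but
      such points accumulate at 0 from the right, which fixes the limit.\<close>
    have "\<exists>\<^sub>F x in at_right 0. ext_expectation (K\<^sub>Y x) (\<lambda>G. quantile G q) =
        ext_expectation (KY x) (\<lambda>G. quantile G q)"
      by (rule density_on_AE_frequently(1)[OF assms(14) \<open>\<delta> > 0\<close> _ l(2,1) AE]) simp
    with a lim(1)[OF q] have a_eq: "a = ?E snd q 0"
      by (rule cond_exp_tendsto_unique)
    have "\<exists>\<^sub>F x in at_left 0. ext_expectation (K\<^sub>Y x) (\<lambda>G. quantile G q) =
        ext_expectation (KY x) (\<lambda>G. quantile G q)"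
      by (rule density_on_AE_frequently(2)[OF assms(14) \<open>\<delta> > 0\<close> _ l(2,1) AE]) simp
    with b lim(2)[OF q] have b_eq: "b = ?E fst q 0"
      by (rule cond_exp_tendsto_unique)
    have "has_expectation (K 0) (\<lambda>y. quantile (snd y) q)" "has_expectation (K 0) (\<lambda>y. quantile (fst y) q)"
      using well_defined q \<open>\<epsilon> > 0\<close> by auto
    \<comment> \<open>After \<open>a\<close> and \<open>b\<close> are replaced by the expectations
      at 0, \<open>fin\<close> is the condition that their difference makes sense. It fails at
      \<open>q = 0\<close>, where both are \<open>-\<infinity>\<close>.\<close>
    note diff = expectation_diff[OF this fin[unfolded a_eq b_eq]]
    show "has_expectation (K 0) (\<lambda>y. effect y q)"
      using diff by (simp add: effect_def)
    show "\<tau> q = a - b"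
      using diff by (simp add: \<tau> effect_def a_eq b_eq)
  qed
qed

end
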